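(* Let $G=(V,E,w)$ be a strongly connected directed graph with positive edge weights and let $\alpha\ge 1$. The following statements are equivalent: (1) $\mathrm{bal}(G)\le\alpha$. (2) There exists a circulation $f$ on $G$ (i.e. $f\ge 0$ with $\mathbf{B}f=0$) such that $f_e/w(e)\in[1,\alpha]$ for every edge $e$. (3) Letting $d=\mathbf{B}w\in\mathbb{R}^V$ be the residual degrees of $G$ (i.e. $d_v$ is the total weight of edges entering $v$ minus the total weight of edges leaving $v$), the demand vector $-d$ can be routed in $G$ with congestion at most $\alpha-1$.
   Context: $\mathbf{B}\in\mathbb{R}^{V\times E}$ is the vertex-edge incidence matrix: $\mathbf{B}_{x,(u,v)}=-1$ if $x=u$, $1$ if $x=v$, and $0$ otherwise. A flow $f\in\mathbb{R}^E$, $f\ge0$, routes a demand vector $b\in\mathbb{R}^V$ if $\mathbf{B}f=b$; its congestion is $\max_e f_e/w(e)$. For $S,T\subseteq V$, $w(S,T)$ is the total weight of edges from $S$ to $T$; $\mathrm{bal}(G)$ is the minimum $\alpha$ with $w(S,V\setminus S)\le\alpha\,w(V\setminus S,S)$ for all $S\subseteq V$. *)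

theory Defs
  imports Complex_Main "Graph_Theory.Digraph_Component"
begin

text \<open>
  A weighted directed graph is a \<open>'a pair_pre_digraph\<close> (vertex set \<open>pverts G\<close>, edge set
  \<open>parcs G\<close> of ordered pairs) with weights \<open>w :: 'a \<times> 'a \<Rightarrow> real\<close>.  Vectors indexed by edges
  or vertices are functions of which only the values on \<open>parcs G\<close> or \<open>pverts G\<close> matter.
\<close>

text \<open>Self-loops are permitted; the column of a loop is zero (its \<open>-1\<close> and \<open>1\<close> cancel).\<close>

definition incidence :: "'a \<Rightarrow> 'a \<times> 'a \<Rightarrow> real" where
  "incidence x e =
     (if fst e = snd e then 0 else if x = fst e then -1 else if x = snd e then 1 else 0)"

definition incidence_mult :: "'a pair_pre_digraph \<Rightarrow> ('a \<times> 'a \<Rightarrow> real) \<Rightarrow> 'a \<Rightarrow> real" where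
  "incidence_mult G f x = (\<Sum>e\<in>parcs G. incidence x e * f e)"

definition routes :: "'a pair_pre_digraph \<Rightarrow> ('a \<times> 'a \<Rightarrow> real) \<Rightarrow> ('a \<Rightarrow> real) \<Rightarrow> bool" where
  "routes G f b \<longleftrightarrow>
     (\<forall>e\<in>parcs G. 0 \<le> f e) \<and> (\<forall>x\<in>pverts G. incidence_mult G f x = b x)"

definition circulation :: "'a pair_pre_digraph \<Rightarrow> ('a \<times> 'a \<Rightarrow> real) \<Rightarrow> bool" where
  "circulation G f \<longleftrightarrow> routes G f (\<lambda>_. 0)"

text \<open>The maximum over an empty edge set is taken to be \<open>0\<close>.\<close>

definition congestion ::
  "'a pair_pre_digraph \<Rightarrow> ('a \<times> 'a \<Rightarrow> real) \<Rightarrow> ('a \<times> 'a \<Rightarrow> real) \<Rightarrow> real" where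
  "congestion G w f =
     (if parcs G = {} then 0 else Max ((\<lambda>e. f e / w e) ` parcs G))"

definition residual_degree ::
  "'a pair_pre_digraph \<Rightarrow> ('a \<times> 'a \<Rightarrow> real) \<Rightarrow> 'a \<Rightarrow> real" where
  "residual_degree G w = incidence_mult G w"

definition cut_weight ::
  "'a pair_pre_digraph \<Rightarrow> ('a \<times> 'a \<Rightarrow> real) \<Rightarrow> 'a set \<Rightarrow> 'a set \<Rightarrow> real" where
  "cut_weight G w S T = sum w {e \<in> parcs G. fst e \<in> S \<and> snd e \<in> T}"

definition balanced ::
  "'a pair_pre_digraph \<Rightarrow> ('a \<times> 'a \<Rightarrow> real) \<Rightarrow> real \<Rightarrow> bool" where
  "balanced G w a \<longleftrightarrow>
     (\<forall>S. S \<subseteq> pverts G \<longrightarrow>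
        cut_weight G w S (pverts G - S) \<le> a * cut_weight G w (pverts G - S) S)"

text \<open>
  The constraint \<open>0 \<le> a\<close> matters only for a one-vertex graph, where every cut is empty and
  without it no minimum would exist; with two or more vertices, strong connectivity and
  positive weights already force \<open>1 \<le> a\<close>.  The lemma \<open>bal_minimum\<close> below shows that
  the minimum exists.
\<close>

definition bal :: "'a pair_pre_digraph \<Rightarrow> ('a \<times> 'a \<Rightarrow> real) \<Rightarrow> real" where
  "bal G w = (LEAST a. 0 \<le> a \<and> balanced G w a)"

lemma closed_set_reach:
  assumes "(u, v) \<in> rtrancl_on V E" and "u \<in> S"
    and "\<And>x y. (x, y) \<in> E \<Longrightarrow> x \<in> S \<Longrightarrow> y \<in> S"
  shows "v \<in> S"
  using assms by (induction rule: rtrancl_on_induct) auto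

lemma cut_weight_eq_0_sym:
  assumes G: "pair_fin_digraph G" and sc: "strongly_connected G"
    and w: "\<forall>e\<in>parcs G. 0 < w e" and S: "S \<subseteq> pverts G"
    and z: "cut_weight G w (pverts G - S) S = 0"
  shows "cut_weight G w S (pverts G - S) = 0"
proof (cases "S = {} \<or> S = pverts G")
  case True
  then show ?thesis by (auto simp: cut_weight_def)
next
  case False
  then obtain u v where uv: "u \<in> pverts G - S" "v \<in> S" using S by blast
  have fin: "finite (parcs G)" using G by (rule pair_fin_digraph.pair_finite_arcs)
  have wf: "pair_wf_digraph G" using G by (simp add: pair_fin_digraph_def)
  have "{e \<in> parcs G. fst e \<in> pverts G - S \<and> snd e \<in> S} = {}"
  proof (rule ccontr)
    assume "{e \<in> parcs G. fst e \<in> pverts G - S \<and> snd e \<in> S} \<noteq> {}"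
    then have "0 < cut_weight G w (pverts G - S) S"
      unfolding cut_weight_def using fin w by (intro sum_pos) auto
    with z show False by simp
  qed
  then have stay: "y \<in> pverts G - S" if "(x, y) \<in> parcs G" "x \<in> pverts G - S" for x y
    using that pair_wf_digraph.in_arcsD2[OF wf that(1)] by force
  have "u \<rightarrow>\<^sup>*\<^bsub>with_proj G\<^esub> v"
    using sc uv S unfolding strongly_connected_def with_proj_simps by blast
  then have "(u, v) \<in> rtrancl_on (pverts G) (parcs G)"
    unfolding reachable_def with_proj_simps .
  then have "v \<in> pverts G - S" using uv(1) stay by (rule closed_set_reach)
  with uv show ?thesis by simp
qed

lemma bal_minimum:
  assumes G: "pair_fin_digraph G" and sc: "strongly_connected G"
    and w: "\<forall>e\<in>parcs G. 0 < w e"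
  shows "0 \<le> bal G w" and "balanced G w (bal G w)"
    and "\<And>a. 0 \<le> a \<Longrightarrow> balanced G w a \<Longrightarrow> bal G w \<le> a"
proof -
  let ?o = "\<lambda>S. cut_weight G w S (pverts G - S)"
  let ?i = "\<lambda>S. cut_weight G w (pverts G - S) S"
  let ?R = "insert 0 ((\<lambda>S. ?o S / ?i S) ` Pow (pverts G))"
  define M where "M = Max ?R"
  have fin: "finite ?R" using pair_fin_digraph.pair_finite_verts[OF G] by simp
  have nonneg: "0 \<le> ?i S" "0 \<le> ?o S" for S
    unfolding cut_weight_def using w by (auto intro!: sum_nonneg simp: less_imp_le)
  have M0: "0 \<le> M" unfolding M_def using fin by (intro Max_ge) auto
  have bM: "balanced G w M"
    unfolding balanced_def
  proof (intro allI impI)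
    fix S assume S: "S \<subseteq> pverts G"
    show "?o S \<le> M * ?i S"
    proof (cases "?i S = 0")
      case True
      then show ?thesis using cut_weight_eq_0_sym[OF G sc w S] by simp
    next
      case False
      then have "0 < ?i S" using nonneg(1)[of S] by linarith
      moreover have "?o S / ?i S \<le> M" unfolding M_def using fin S by (intro Max_ge) auto
      ultimately show ?thesis by (simp add: pos_divide_le_eq)
    qed
  qed
  have least: "M \<le> a" if a: "0 \<le> a" "balanced G w a" for a
  proof -
    have "?o S / ?i S \<le> a" if S: "S \<subseteq> pverts G" for S
    proof (cases "?i S = 0")
      case False
      then have "0 < ?i S" using nonneg(1)[of S] by linarith
      then show ?thesis using a S by (simp add: balanced_def pos_divide_le_eq)
    qed (use a in simp)
    then show ?thesis unfolding M_def using fin a by (subst Max_le_iff) auto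
  qed
  have "bal G w = M"
    unfolding bal_def by (rule Least_equality) (use M0 bM least in auto)
  then show "0 \<le> bal G w" and "balanced G w (bal G w)"
    and "\<And>a. 0 \<le> a \<Longrightarrow> balanced G w a \<Longrightarrow> bal G w \<le> a"
    using M0 bM least by auto
qed

end

theory Submission
  imports Defs
begin

text \<open>
  The core is Hoffman's circulation theorem: a flow between the bounds \<open>l\<close> and \<open>u\<close> conserved
  at every vertex exists as soon as \<open>u(out S) - l(in S) \<ge> 0\<close> for all \<open>S\<close>.
  This slack is submodular in \<open>S\<close>, so the constraints that the cuts impose on the value of a
  single edge are compatible.  The edges can hence be fixed one after the other while keeping
  all slacks nonnegative; once \<open>l = u\<close>, the slacks of \<open>{x}\<close> and of its complement are opposite,
  which is conservation at \<open>x\<close>.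
  The equivalence of (2) and (3) is the substitution \<open>f = w + g\<close>.
\<close>

text \<open>The cut condition is split into one term per edge, so that identities and inequalities
  between slacks can be checked edge by edge. \<open>S\<close> ranges over all sets of the type,
  which makes \<open>- S\<close> available as the complement.\<close>

definition edge_slack ::
  "('a \<times> 'a \<Rightarrow> real) \<Rightarrow> ('a \<times> 'a \<Rightarrow> real) \<Rightarrow> 'a set \<Rightarrow> 'a \<times> 'a \<Rightarrow> real" where
  "edge_slack l u S e =
     (if fst e \<in> S \<and> snd e \<notin> S then u e else if fst e \<notin> S \<and> snd e \<in> S then - l e else 0)"

definition slack ::
  "('a \<times> 'a) set \<Rightarrow> ('a \<times> 'a \<Rightarrow> real) \<Rightarrow> ('a \<times> 'a \<Rightarrow> real) \<Rightarrow> 'a set \<Rightarrow> real" where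
  "slack E l u S = (\<Sum>e\<in>E. edge_slack l u S e)"

text \<open>Edge by edge, both sides agree unless the edge joins \<open>S - T\<close> and
  \<open>T - S\<close>. Such an edge contributes 0 on the left and \<open>u e - l e\<close> on the
  right.\<close>

lemma slack_submodular:
  assumes "\<And>e. e \<in> E \<Longrightarrow> l e \<le> u e"
  shows "slack E l u (S \<union> T) + slack E l u (S \<inter> T) \<le> slack E l u S + slack E l u T"
  unfolding slack_def sum.distrib[symmetric]
  by (rule sum_mono) (use assms in \<open>auto simp: edge_slack_def\<close>)

lemma slack_Compl: "slack E f f (- S) = - slack E f f S"
  unfolding slack_def sum_negf[symmetric]
  by (rule sum.cong) (auto simp: edge_slack_def)

lemma slack_remove:
  "finite E \<Longrightarrow> e \<in> E \<Longrightarrow> slack E l u S = edge_slack l u S e + slack (E - {e}) l u S"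
  unfolding slack_def by (rule sum.remove)

lemma slack_fun_upd: "slack (E - {e}) (l(e := s)) (u(e := t)) S = slack (E - {e}) l u S"
  unfolding slack_def by (rule sum.cong) (auto simp: edge_slack_def)

lemma exists_between:
  fixes A B :: "real set"
  assumes "A \<noteq> {}" "B \<noteq> {}" and le: "\<And>a b. a \<in> A \<Longrightarrow> b \<in> B \<Longrightarrow> a \<le> b"
  shows "\<exists>t. (\<forall>a\<in>A. a \<le> t) \<and> (\<forall>b\<in>B. t \<le> b)"
proof (intro exI conjI ballI)
  have "bdd_above A" using \<open>B \<noteq> {}\<close> le by (meson bdd_aboveI equals0I)
  then show "a \<le> Sup A" if "a \<in> A" for a using that by (rule cSup_upper[rotated])
  show "Sup A \<le> b" if "b \<in> B" for b using that assms by (intro cSup_least) auto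
qed

text \<open>With the other edges left alone, a set that \<open>e\<close> leaves bounds
  \<open>t\<close> from below, a set that \<open>e\<close> enters bounds it from above, and any
  other set does not constrain \<open>t\<close>. It remains to see that no lower bound exceeds an
  upper bound.\<close>

lemma fix_edge_value:
  assumes fin: "finite E" and e: "e \<in> E"
    and lu: "\<And>e. e \<in> E \<Longrightarrow> l e \<le> u e" and pos: "\<And>S. 0 \<le> slack E l u S"
  obtains t where "l e \<le> t" "t \<le> u e" "\<And>S. 0 \<le> slack E (l(e := t)) (u(e := t)) S"
proof -
  let ?r = "slack (E - {e}) l u"
  let ?out = "{S. fst e \<in> S \<and> snd e \<notin> S}" and ?in = "{S. fst e \<notin> S \<and> snd e \<in> S}"
  note split = slack_remove[OF fin e]
  have r: "0 \<le> edge_slack l u S e + ?r S" for S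
    using pos[of S] by (simp add: split)
  have out: "- ?r S \<le> u e" if "S \<in> ?out" for S
    using r[of S] that by (simp add: edge_slack_def)
  have "in": "l e \<le> ?r S" if "S \<in> ?in" for S
    using r[of S] that by (simp add: edge_slack_def)
  \<comment> \<open>Both ends of \<open>e\<close> lie in \<open>S \<union> T\<close> and neither
    lies in \<open>S \<inter> T\<close>, so \<open>e\<close> adds nothing to these two slacks and
    \<open>?r\<close> is nonnegative there.\<close>
  have cross: "- ?r T \<le> ?r S" if "T \<in> ?out" "S \<in> ?in" for S T
  proof -
    have "0 \<le> ?r (S \<union> T)" "0 \<le> ?r (S \<inter> T)"
      using r[of "S \<union> T"] r[of "S \<inter> T"] that by (auto simp: edge_slack_def)
    moreover have "?r (S \<union> T) + ?r (S \<inter> T) \<le> ?r S + ?r T"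
      by (rule slack_submodular) (use lu in auto)
    ultimately show ?thesis by linarith
  qed
  \<comment> \<open>Adding \<open>l e\<close> and \<open>u e\<close> keeps \<open>t\<close> within
    the old bounds and makes both sets nonempty, even when \<open>e\<close> is a loop and crosses no
    cut.\<close>
  let ?A = "insert (l e) ((\<lambda>T. - ?r T) ` ?out)" and ?B = "insert (u e) (?r ` ?in)"
  have le: "a \<le> b" if "a \<in> ?A" "b \<in> ?B" for a b
    using that
    by (elim insertE imageE) (simp_all only: lu[OF e] out "in" cross)
  have "\<exists>t. (\<forall>a\<in>?A. a \<le> t) \<and> (\<forall>b\<in>?B. t \<le> b)"
    using insert_not_empty insert_not_empty le by (rule exists_between)
  then obtain t where a: "\<forall>a\<in>?A. a \<le> t" and b: "\<forall>b\<in>?B. t \<le> b"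
    by (elim exE conjE)
  show thesis
  proof
    show "l e \<le> t" "t \<le> u e" using a b by auto
    fix S
    have "- ?r S \<le> t" if "S \<in> ?out" using that a by blast
    moreover have "t \<le> ?r S" if "S \<in> ?in" using that b by blast
    moreover have "0 \<le> ?r S" if "S \<notin> ?out" "S \<notin> ?in"
      using r[of S] that by (auto simp: edge_slack_def split: if_splits)
    ultimately show "0 \<le> slack E (l(e := t)) (u(e := t)) S"
      by (auto simp: split slack_fun_upd edge_slack_def)
  qed
qed

text \<open>Only \<open>F\<close> grows in the induction; the slacks are always taken over all of
  \<open>E\<close>, so the invariant is the hypothesis of \<open>fix_edge_value\<close>.\<close>

lemma fix_edge_values:
  assumes fin: "finite E" and lu: "\<And>e. e \<in> E \<Longrightarrow> l e \<le> u e"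
    and pos: "\<And>S. 0 \<le> slack E l u S" and "F \<subseteq> E"
  shows "\<exists>l' u'. (\<forall>e\<in>E. l e \<le> l' e \<and> l' e \<le> u' e \<and> u' e \<le> u e) \<and> (\<forall>e\<in>F. l' e = u' e) \<and>
           (\<forall>S. 0 \<le> slack E l' u' S)"
  using finite_subset[OF \<open>F \<subseteq> E\<close> fin] \<open>F \<subseteq> E\<close>
proof (induction F)
  case empty
  then show ?case using lu pos by (intro exI[of _ l] exI[of _ u]) auto
next
  case (insert e F)
  then obtain l' u' where *: "\<And>e. e \<in> E \<Longrightarrow> l e \<le> l' e \<and> l' e \<le> u' e \<and> u' e \<le> u e"
    "\<And>e. e \<in> F \<Longrightarrow> l' e = u' e" "\<And>S. 0 \<le> slack E l' u' S"
    by blast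
  obtain t where t: "l' e \<le> t" "t \<le> u' e" "\<And>S. 0 \<le> slack E (l'(e := t)) (u'(e := t)) S"
    by (rule fix_edge_value[OF fin, of e l' u']) (use * insert.prems in auto)
  have "l e \<le> t" "t \<le> u e"
    using *(1)[of e] t(1,2) insert.prems by auto
  then have bounds: "\<forall>e'\<in>E. l e' \<le> (l'(e := t)) e' \<and> (l'(e := t)) e' \<le> (u'(e := t)) e' \<and>
      (u'(e := t)) e' \<le> u e'"
    using *(1) by (metis fun_upd_apply order_refl)
  have "\<forall>e'\<in>insert e F. (l'(e := t)) e' = (u'(e := t)) e'"
    using *(2) by simp
  with bounds show ?case
    by - (rule exI[of _ "l'(e := t)"], rule exI[of _ "u'(e := t)"], intro conjI allI t(3))
qed

lemma incidence_mult_eq_slack: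
  "incidence_mult G f x = - slack (parcs G) f f {x}"
  unfolding incidence_mult_def slack_def sum_negf[symmetric]
  by (rule sum.cong) (auto simp: edge_slack_def incidence_def)

theorem hoffman_circulation:
  assumes fin: "finite (parcs G)" and lu: "\<And>e. e \<in> parcs G \<Longrightarrow> l e \<le> u e"
    and pos: "\<And>S. 0 \<le> slack (parcs G) l u S"
  obtains f where "\<And>e. e \<in> parcs G \<Longrightarrow> l e \<le> f e \<and> f e \<le> u e" "\<And>x. incidence_mult G f x = 0"
proof -
  obtain f g where f: "\<And>e. e \<in> parcs G \<Longrightarrow> l e \<le> f e \<and> g e \<le> u e"
    "\<And>e. e \<in> parcs G \<Longrightarrow> f e = g e" "\<And>S. 0 \<le> slack (parcs G) f g S"
    using fix_edge_values[OF fin lu pos order_refl] by blast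
  \<comment> \<open>\<open>f\<close> and \<open>g\<close> agree on edges only, so the slack is
    rewritten before \<open>slack_Compl\<close> can be applied.\<close>
  have "slack (parcs G) f g S = slack (parcs G) f f S" for S
    unfolding slack_def by (rule sum.cong) (auto simp: edge_slack_def f(2))
  then have "0 \<le> slack (parcs G) f f S" for S using f(3) by metis
  then have "slack (parcs G) f f {x} = 0" for x
    using slack_Compl[of "parcs G" f "{x}"] by (smt (verit))
  then show thesis using f by (intro that[of f]) (auto simp: incidence_mult_eq_slack)
qed

text \<open>Both ends of every edge are vertices, so only the part of \<open>S\<close> inside
  \<open>pverts G\<close> matters. This links slacks of arbitrary sets to the cuts in
  \<open>balanced\<close>.\<close>

lemma slack_eq_cut_weight:
  assumes G: "pair_fin_digraph G"
  shows "slack (parcs G) l u S =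
    cut_weight G u (pverts G \<inter> S) (pverts G - S) - cut_weight G l (pverts G - S) (pverts G \<inter> S)"
proof -
  have fin: "finite (parcs G)" using G by (rule pair_fin_digraph.pair_finite_arcs)
  have wf: "pair_wf_digraph G" using G by (simp add: pair_fin_digraph_def)
  show ?thesis
    unfolding slack_def cut_weight_def sum.inter_filter[OF fin] sum_subtractf[symmetric]
    by (rule sum.cong)
      (auto simp: edge_slack_def dest: pair_wf_digraph.in_arcsD1[OF wf] pair_wf_digraph.in_arcsD2[OF wf])
qed

text \<open>Edges inside \<open>S\<close> cancel in the sum, which leaves the net flow into
  \<open>S\<close>.\<close>

lemma sum_incidence_mult:
  assumes "finite S"
  shows "(\<Sum>x\<in>S. incidence_mult G f x) = - slack (parcs G) f f S"
proof -
  have "(\<Sum>x\<in>S. incidence x e * f e) = - edge_slack f f S e" for e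
  proof -
    \<comment> \<open>This form also covers loops, where the two indicators cancel.\<close>
    have "incidence x e = of_bool (x = snd e) - of_bool (x = fst e)" for x
      by (auto simp: incidence_def)
    then have "(\<Sum>x\<in>S. incidence x e) = of_bool (snd e \<in> S) - of_bool (fst e \<in> S)"
      using assms by (simp add: sum_subtractf of_bool_def)
    then show ?thesis
      unfolding sum_distrib_right[symmetric] by (auto simp: edge_slack_def)
  qed
  then show ?thesis
    unfolding incidence_mult_def slack_def by (subst sum.swap) (simp add: sum_negf)
qed

lemma balanced_imp_circulation:
  assumes G: "pair_fin_digraph G" and w: "\<forall>e\<in>parcs G. 0 < w e" and \<alpha>: "1 \<le> \<alpha>"
    and b: "balanced G w \<alpha>"
  shows "\<exists>f. circulation G f \<and> (\<forall>e\<in>parcs G. f e / w e \<in> {1..\<alpha>})"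
proof -
  have "0 \<le> slack (parcs G) w (\<lambda>e. \<alpha> * w e) S" for S
  proof -
    \<comment> \<open>With bounds \<open>w\<close> and \<open>\<alpha> * w\<close>, the slack
      condition for \<open>S\<close> is the balance condition for the complement of
      \<open>S\<close>, since \<open>balanced\<close> puts the factor on the entering edges.\<close>
    have "pverts G - (pverts G - S) = pverts G \<inter> S" by auto
    then show ?thesis
      using b[unfolded balanced_def, rule_format, of "pverts G - S"]
      by (simp add: slack_eq_cut_weight[OF G] cut_weight_def sum_distrib_left)
  qed
  moreover have "w e \<le> \<alpha> * w e" if "e \<in> parcs G" for e
    using w that \<alpha> by simp
  ultimately obtain f where f: "\<And>e. e \<in> parcs G \<Longrightarrow> w e \<le> f e \<and> f e \<le> \<alpha> * w e"
    "\<And>x. incidence_mult G f x = 0"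
    using hoffman_circulation[OF pair_fin_digraph.pair_finite_arcs[OF G], of w "\<lambda>e. \<alpha> * w e"]
    by blast
  have "0 \<le> f e" if "e \<in> parcs G" for e using f(1)[OF that] w that by force
  then show ?thesis
    using f w by (intro exI[of _ f])
      (auto simp: circulation_def routes_def pos_divide_le_eq pos_le_divide_eq)
qed

text \<open>A circulation carries equal amounts across a cut in both directions; \<open>w\<close>
  bounds the one from below and \<open>\<alpha> * w\<close> the other from above.\<close>

lemma circulation_imp_balanced:
  assumes G: "pair_fin_digraph G" and w: "\<forall>e\<in>parcs G. 0 < w e"
    and f: "circulation G f" "\<forall>e\<in>parcs G. f e / w e \<in> {1..\<alpha>}"
  shows "balanced G w \<alpha>"
  unfolding balanced_def
proof (intro allI impI)
  fix S assume S: "S \<subseteq> pverts G"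
  have bounds: "w e \<le> f e \<and> f e \<le> \<alpha> * w e" if "e \<in> parcs G" for e
    using f(2) w that by (simp add: pos_divide_le_eq pos_le_divide_eq)
  have "finite S" using S pair_fin_digraph.pair_finite_verts[OF G] by (rule finite_subset)
  moreover have "(\<Sum>x\<in>S. incidence_mult G f x) = 0"
    using f(1) S by (intro sum.neutral) (auto simp: circulation_def routes_def)
  ultimately have "slack (parcs G) f f S = 0" by (simp add: sum_incidence_mult)
  then have conserve: "cut_weight G f S (pverts G - S) = cut_weight G f (pverts G - S) S"
    using S by (simp add: slack_eq_cut_weight[OF G] Int_absorb1)
  have "cut_weight G w S (pverts G - S) \<le> cut_weight G f S (pverts G - S)"
    unfolding cut_weight_def by (rule sum_mono) (use bounds in auto)
  also note conserve
  also have "cut_weight G f (pverts G - S) S \<le> \<alpha> * cut_weight G w (pverts G - S) S"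
    unfolding cut_weight_def sum_distrib_left by (rule sum_mono) (use bounds in auto)
  finally show "cut_weight G w S (pverts G - S) \<le> \<alpha> * cut_weight G w (pverts G - S) S" .
qed

lemma balanced_mono:
  assumes "balanced G w a" "a \<le> b" "\<forall>e\<in>parcs G. 0 < w e"
  shows "balanced G w b"
  unfolding balanced_def
proof (intro allI impI)
  fix S assume "S \<subseteq> pverts G"
  then have "cut_weight G w S (pverts G - S) \<le> a * cut_weight G w (pverts G - S) S"
    using assms(1) by (simp add: balanced_def)
  also have "\<dots> \<le> b * cut_weight G w (pverts G - S) S"
    using assms(2,3) unfolding cut_weight_def
    by (intro mult_right_mono sum_nonneg) (auto simp: less_imp_le)
  finally show "cut_weight G w S (pverts G - S) \<le> b * cut_weight G w (pverts G - S) S" .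
qed

text \<open>The sign of \<open>c\<close> settles the graph without edges, whose congestion is 0 by
  convention.\<close>

lemma congestion_le_iff:
  assumes "finite (parcs G)" "0 \<le> c"
  shows "congestion G w f \<le> c \<longleftrightarrow> (\<forall>e\<in>parcs G. f e / w e \<le> c)"
  using assms by (auto simp: congestion_def)

lemma incidence_mult_add:
  "incidence_mult G (\<lambda>e. f e + g e) x = incidence_mult G f x + incidence_mult G g x"
  by (simp add: incidence_mult_def distrib_left sum.distrib)

lemma incidence_mult_diff:
  "incidence_mult G (\<lambda>e. f e - g e) x = incidence_mult G f x - incidence_mult G g x"
  by (simp add: incidence_mult_def right_diff_distrib sum_subtractf)

text \<open>Subtracting \<open>w\<close> turns the lower bound 1 on \<open>f e / w e\<close> into
  nonnegativity of the routed flow and the upper bound \<open>\<alpha>\<close> into congestion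
  \<open>\<alpha> - 1\<close>.\<close>

lemma circulation_iff_routes_residual:
  assumes fin: "finite (parcs G)" and w: "\<forall>e\<in>parcs G. 0 < w e" and \<alpha>: "1 \<le> \<alpha>"
  shows "(\<exists>f. circulation G f \<and> (\<forall>e\<in>parcs G. f e / w e \<in> {1..\<alpha>})) \<longleftrightarrow>
    (\<exists>g. routes G g (\<lambda>x. - residual_degree G w x) \<and> congestion G w g \<le> \<alpha> - 1)"
    (is "?L \<longleftrightarrow> ?R")
proof
  assume ?L
  then obtain f where f: "circulation G f" "\<forall>e\<in>parcs G. f e / w e \<in> {1..\<alpha>}" by blast
  have bounds: "w e \<le> f e \<and> f e \<le> \<alpha> * w e" if "e \<in> parcs G" for e
    using f(2) w that by (simp add: pos_divide_le_eq pos_le_divide_eq)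
  have "congestion G w (\<lambda>e. f e - w e) \<le> \<alpha> - 1"
    using bounds w \<alpha> fin
    by (auto simp: congestion_le_iff pos_divide_le_eq left_diff_distrib)
  then show ?R
    using f(1) bounds by (intro exI[of _ "\<lambda>e. f e - w e"])
      (auto simp: circulation_def routes_def residual_degree_def incidence_mult_diff)
next
  assume ?R
  then obtain g where g: "routes G g (\<lambda>x. - residual_degree G w x)" "congestion G w g \<le> \<alpha> - 1"
    by blast
  have bounds: "0 \<le> g e \<and> g e \<le> (\<alpha> - 1) * w e" if "e \<in> parcs G" for e
    using g w \<alpha> fin that by (simp add: routes_def congestion_le_iff pos_divide_le_eq)
  have "(w e + g e) / w e \<in> {1..\<alpha>}" if "e \<in> parcs G" for e
    using bounds[OF that] w that by (simp add: pos_divide_le_eq pos_le_divide_eq left_diff_distrib)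
  moreover have "0 \<le> w e + g e" if "e \<in> parcs G" for e
    using bounds w that by (simp add: less_imp_le)
  then have "circulation G (\<lambda>e. w e + g e)"
    using g(1) by (simp add: circulation_def routes_def residual_degree_def incidence_mult_add)
  ultimately show ?L by blast
qed

theorem mainTheorem6:
  fixes G :: "'a pair_pre_digraph" and w :: "'a \<times> 'a \<Rightarrow> real" and \<alpha> :: real
  assumes "pair_fin_digraph G" and "strongly_connected G"
    and "\<forall>e\<in>parcs G. 0 < w e" and "1 \<le> \<alpha>"
  shows "(bal G w \<le> \<alpha> \<longleftrightarrow>
           (\<exists>f. circulation G f \<and> (\<forall>e\<in>parcs G. f e / w e \<in> {1..\<alpha>}))) \<and>
         ((\<exists>f. circulation G f \<and> (\<forall>e\<in>parcs G. f e / w e \<in> {1..\<alpha>})) \<longleftrightarrow>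
           (\<exists>g. routes G g (\<lambda>x. - residual_degree G w x) \<and> congestion G w g \<le> \<alpha> - 1))"
proof -
  note G = assms(1) and w = assms(3) and \<alpha> = assms(4)
  note bal = bal_minimum[OF assms(1-3)]
  \<comment> \<open>Forwards, balance at the attained minimum passes to the larger
    \<open>\<alpha>\<close>; backwards is minimality, where \<open>1 \<le> \<alpha>\<close> supplies
    the sign condition in \<open>bal\<close>.\<close>
  have "bal G w \<le> \<alpha> \<longleftrightarrow> balanced G w \<alpha>"
    using bal(2) bal(3)[of \<alpha>] balanced_mono[OF _ _ w] \<alpha> by auto
  also have "\<dots> \<longleftrightarrow> (\<exists>f. circulation G f \<and> (\<forall>e\<in>parcs G. f e / w e \<in> {1..\<alpha>}))"
    using balanced_imp_circulation[OF G w \<alpha>] circulation_imp_balanced[OF G w] by blast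
  finally show ?thesis
    using circulation_iff_routes_residual[OF pair_fin_digraph.pair_finite_arcs[OF G] w \<alpha>] by blast
qed

end
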